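(* (i) If $\mathcal{D}$ is a distributive lattice and $X_{\mathcal{D}}$ is its associated Stone space, then every closed subspace of $X_{\mathcal{D}}$ is extremally disconnected if and only if $\mathcal{D}$ is a Gödel-Dummett distributive lattice. (ii) If $(\mathcal{M},\le)$ is a meet-semilattice and $X_{\mathcal{M}}$ is the ideal topological space associated to $\mathcal{M}$, then every closed subspace of $X_{\mathcal{M}}$ is extremally disconnected if and only if for every $p,q\in\mathcal{M}$ such that $p,q\le r$ for some $r\in\mathcal{M}$, either $p\le q$ or $q\le p$. (iii) If $(\mathcal{P},\le)$ is a preorder and $A_{\mathcal{P}}$ is the Alexandrov space associated to $\mathcal{P}$, then every closed subspace of $A_{\mathcal{P}}$ is extremally disconnected if and only if for every $p,q\in\mathcal{P}$ such that $r\le p,q$ for some $r\in\mathcal{P}$, either $p\le q$ or $q\le p$.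
   Context: A space is extremally disconnected if the closure of every open set is open. The Stone space $X_{\mathcal{D}}$ of a distributive lattice (with $0,1$) is the set of prime filters with the topology having as basis the sets $\{F\mid d\in F\}$, $d\in\mathcal{D}$ (the axiom of choice is assumed). The ideal topological space $X_{\mathcal{M}}$ of a meet-semilattice (with top) is the set of filters on $\mathcal{M}$ (upper sets containing $1$ and closed under binary meets) with the topology having as basis the sets $\{F\mid m\in F\}$, $m\in\mathcal{M}$. The Alexandrov space $A_{\mathcal{P}}$ is the set $\mathcal{P}$ with the upper sets as open sets. Given sets $A=\{a_i\le x\mid i\in I\}$ and $B=\{b_j\le x\mid j\in J\}$ of elements of $\mathcal{D}$ below $x\in\mathcal{D}$, $A$ refines $B$ if for every $i\in I$ there is $j\in J$ with $a_i\le b_j$. $A=\{a_i\le x\mid i\in I\}$ is finitely closed if for every $b\le x$, if there is a finite (possibly empty) subset $I'\subseteq I$ with $b=\bigvee_{i\in I'}(a_i\wedge b)$, then $b\le a_i$ for some $i\in I$. $\mathcal{D}$ is a Gödel-Dummett distributive lattice if for any $x\in\mathcal{D}$ and any finitely closed sets $A=\{a_i\le x\mid i\in I\}$ and $B=\{b_j\le x\mid j\in J\}$ there is a finite collection $\{c_k\mid k\in K\}$ with $x=\bigvee_{k\in K}c_k$ such that for each $k\in K$ either $\{a_i\wedge c_k\le c_k\mid i\in I\}$ refines $\{b_j\wedge c_k\le c_k\mid j\in J\}$ or conversely. *)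

theory Defs
  imports "HOL-Analysis.Abstract_Topology"
begin

definition extremally_disconnected :: "'a topology \<Rightarrow> bool" where
  "extremally_disconnected X \<longleftrightarrow> (\<forall>U. openin X U \<longrightarrow> openin X (X closure_of U))"

text \<open>Filters need not be proper.\<close>

definition semilattice_filter :: "'a::bounded_semilattice_inf_top set \<Rightarrow> bool" where
  "semilattice_filter F \<longleftrightarrow>
     top \<in> F \<and> (\<forall>a\<in>F. \<forall>b. a \<le> b \<longrightarrow> b \<in> F) \<and> (\<forall>a\<in>F. \<forall>b\<in>F. inf a b \<in> F)"

definition ideal_space :: "'a::bounded_semilattice_inf_top set topology" where
  "ideal_space =
     topology (arbitrary union_of (\<lambda>U. \<exists>m. U = {F. semilattice_filter F \<and> m \<in> F}))"

text \<open>The function \<^const>\<open>topology\<close> is only meaningful on families satisfying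
  \<^const>\<open>istopology\<close>; the following two lemmas, and their analogues below, show that the spaces
  have the intended open sets and points.\<close>

lemma openin_ideal_space:
  "openin ideal_space =
     arbitrary union_of (\<lambda>U. \<exists>m. U = {F. semilattice_filter F \<and> m \<in> F})"
  unfolding ideal_space_def
proof (rule topology_inverse', rule istopology_base)
  fix S T :: "'a set set"
  assume "\<exists>m. S = {F. semilattice_filter F \<and> m \<in> F}" "\<exists>m. T = {F. semilattice_filter F \<and> m \<in> F}"
  then obtain m n where "S = {F. semilattice_filter F \<and> m \<in> F}" "T = {F. semilattice_filter F \<and> n \<in> F}"
    by blast
  then have "S \<inter> T = {F. semilattice_filter F \<and> inf m n \<in> F}"
    unfolding semilattice_filter_def by (auto; meson inf_le1 inf_le2)
  then show "\<exists>m. S \<inter> T = {F. semilattice_filter F \<and> m \<in> F}" ..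
qed

lemma topspace_ideal_space: "topspace ideal_space = {F. semilattice_filter F}"
proof
  show "topspace ideal_space \<subseteq> {F::'a set. semilattice_filter F}"
    unfolding topspace_def openin_ideal_space union_of_def by blast
  have "{F::'a set. semilattice_filter F} = {F. semilattice_filter F \<and> top \<in> F}"
    by (auto simp: semilattice_filter_def)
  then have "openin ideal_space {F::'a set. semilattice_filter F}"
    unfolding openin_ideal_space by (intro arbitrary_union_of_inc) blast
  then show "{F::'a set. semilattice_filter F} \<subseteq> topspace ideal_space"
    by (rule openin_subset)
qed

definition prime_filter :: "'a::{distrib_lattice, bounded_lattice} set \<Rightarrow> bool" where
  "prime_filter F \<longleftrightarrow>
     semilattice_filter F \<and> bot \<notin> F \<and> (\<forall>a b. sup a b \<in> F \<longrightarrow> a \<in> F \<or> b \<in> F)"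

definition stone_space :: "'a::{distrib_lattice, bounded_lattice} set topology" where
  "stone_space =
     topology (arbitrary union_of (\<lambda>U. \<exists>d. U = {F. prime_filter F \<and> d \<in> F}))"

lemma openin_stone_space:
  "openin stone_space =
     arbitrary union_of (\<lambda>U. \<exists>d. U = {F. prime_filter F \<and> d \<in> F})"
  unfolding stone_space_def
proof (rule topology_inverse', rule istopology_base)
  fix S T :: "'a set set"
  assume "\<exists>d. S = {F. prime_filter F \<and> d \<in> F}" "\<exists>d. T = {F. prime_filter F \<and> d \<in> F}"
  then obtain d e where "S = {F. prime_filter F \<and> d \<in> F}" "T = {F. prime_filter F \<and> e \<in> F}"
    by blast
  then have "S \<inter> T = {F. prime_filter F \<and> inf d e \<in> F}"
    unfolding prime_filter_def semilattice_filter_def by (auto; meson inf_le1 inf_le2)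
  then show "\<exists>d. S \<inter> T = {F. prime_filter F \<and> d \<in> F}" ..
qed

lemma topspace_stone_space: "topspace stone_space = {F. prime_filter F}"
proof
  show "topspace stone_space \<subseteq> {F::'a set. prime_filter F}"
    unfolding topspace_def openin_stone_space union_of_def by blast
  have "{F::'a set. prime_filter F} = {F. prime_filter F \<and> top \<in> F}"
    by (auto simp: prime_filter_def semilattice_filter_def)
  then have "openin stone_space {F::'a set. prime_filter F}"
    unfolding openin_stone_space by (intro arbitrary_union_of_inc) blast
  then show "{F::'a set. prime_filter F} \<subseteq> topspace stone_space"
    by (rule openin_subset)
qed

definition alexandrov_space :: "'a set \<Rightarrow> ('a \<times> 'a) set \<Rightarrow> 'a topology" where
  "alexandrov_space P r =
     topology (\<lambda>U. U \<subseteq> P \<and> (\<forall>x\<in>U. \<forall>y\<in>P. (x, y) \<in> r \<longrightarrow> y \<in> U))"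

lemma openin_alexandrov_space:
  "openin (alexandrov_space P r) U \<longleftrightarrow> U \<subseteq> P \<and> (\<forall>x\<in>U. \<forall>y\<in>P. (x, y) \<in> r \<longrightarrow> y \<in> U)"
proof -
  have "istopology (\<lambda>U. U \<subseteq> P \<and> (\<forall>x\<in>U. \<forall>y\<in>P. (x, y) \<in> r \<longrightarrow> y \<in> U))"
    unfolding istopology_def by blast
  then show ?thesis
    unfolding alexandrov_space_def by simp
qed

lemma topspace_alexandrov_space: "topspace (alexandrov_space P r) = P"
  unfolding topspace_def openin_alexandrov_space by blast

text \<open>The join of a finite, possibly empty set; it has no meaning for infinite sets.\<close>

definition finite_join :: "'a::bounded_lattice set \<Rightarrow> 'a" where
  "finite_join A = Sup_fin (insert bot A)"

text \<open>The families \<open>{a\<^sub>i \<le> x | i \<in> I}\<close> are represented by the sets of their members.\<close>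

definition refines :: "'a::{distrib_lattice, bounded_lattice} set \<Rightarrow> 'a set \<Rightarrow> bool" where
  "refines A B \<longleftrightarrow> (\<forall>a\<in>A. \<exists>b\<in>B. a \<le> b)"

text \<open>The choice \<open>S = {}\<close>, \<open>b = bot\<close> shows that a finitely closed set is nonempty.\<close>

definition finitely_closed :: "'a::{distrib_lattice, bounded_lattice} \<Rightarrow> 'a set \<Rightarrow> bool" where
  "finitely_closed x A \<longleftrightarrow>
     (\<forall>a\<in>A. a \<le> x) \<and>
     (\<forall>b\<le>x. (\<exists>S. finite S \<and> S \<subseteq> A \<and> b = finite_join ((\<lambda>a. inf a b) ` S)) \<longrightarrow>
        (\<exists>a\<in>A. b \<le> a))"

definition goedel_dummett :: "'a::{distrib_lattice, bounded_lattice} itself \<Rightarrow> bool" where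
  "goedel_dummett _ \<longleftrightarrow>
     (\<forall>(x::'a) A B. finitely_closed x A \<and> finitely_closed x B \<longrightarrow>
        (\<exists>C. finite C \<and> x = finite_join C \<and>
           (\<forall>c\<in>C. refines ((\<lambda>a. inf a c) ` A) ((\<lambda>b. inf b c) ` B) \<or>
                   refines ((\<lambda>b. inf b c) ` B) ((\<lambda>a. inf a c) ` A))))"

end

theory Submission
  imports Defs
begin

text \<open>
  Extremal disconnectedness of all closed subspaces of a space \<open>X\<close> is a condition on the lattice of
  open sets alone: it is the Goedel-Dummett law \<open>(U \<rightarrow> V) \<union> (V \<rightarrow> U) = X\<close> of its Heyting algebra, which
  says that each point has a neighbourhood on which one of \<open>U\<close>, \<open>V\<close> contains the other. Indeed, the
  closed set \<open>X - U \<inter> V\<close> contains \<open>U - V\<close> and \<open>V - U\<close> as disjoint open sets; if the closure of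
  the first is open there, it is clopen and separates the two. Conversely, to see that the closure
  of an open subset of a closed \<open>C\<close> is open in \<open>C\<close>, one compares this subset with the complement of
  its closure.
  This is the lemma \<open>closed_subspaces_extremally_disconnected_iff\<close>.

  It remains to read the law off a base. In an Alexandrov space every point has a least
  neighbourhood, its principal upper set, so the law says that each of these upper sets is
  linearly preordered. In the ideal space every basic open set has a least point, the principal
  filter; hence the law for the basic sets of \<open>p, q \<le> r\<close>, taken at the principal filter of \<open>r\<close>, yields the
  comparability of \<open>p\<close> and \<open>q\<close>. Conversely, as \<open>r\<close> may be the top element, comparability makes the
  semilattice a chain; then the basic sets form a chain under inclusion, and so do their unions.

  In the Stone space the open sets correspond to the ideals of the lattice. A set of elements below
  \<open>x\<close> is finitely closed exactly if its down-closure is an ideal (\<open>finitely_closed_iff\<close>), and the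
  refinement relation compares these ideals. So the Goedel-Dummett condition states the law for
  ideals below \<open>x\<close>, locally on a finite cover of \<open>x\<close>. A cover of the top element has a member in any
  given prime filter, which gives the law at each point; in the other direction the prime filter
  theorem turns inclusions of open sets into refinements, and also provides the compactness that
  makes the cover finite.
\<close>

section \<open>The Goedel-Dummett law for open sets\<close>

definition prelinear_opens :: "'a topology \<Rightarrow> bool" where
  "prelinear_opens X \<longleftrightarrow>
     (\<forall>U V. openin X U \<longrightarrow> openin X V \<longrightarrow>
        (\<forall>x\<in>topspace X. \<exists>W. openin X W \<and> x \<in> W \<and> (W \<inter> U \<subseteq> V \<or> W \<inter> V \<subseteq> U)))"

lemma prelinear_opensI:
  assumes "\<And>U V x. \<lbrakk>openin X U; openin X V; x \<in> topspace X\<rbrakk> \<Longrightarrow>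
             \<exists>W. openin X W \<and> x \<in> W \<and> (W \<inter> U \<subseteq> V \<or> W \<inter> V \<subseteq> U)"
  shows "prelinear_opens X"
  unfolding prelinear_opens_def by (intro allI impI ballI assms)

lemma prelinear_opensE:
  assumes "prelinear_opens X" "openin X U" "openin X V" "x \<in> topspace X"
  obtains W where "openin X W" "x \<in> W" "W \<inter> U \<subseteq> V \<or> W \<inter> V \<subseteq> U"
  using assms unfolding prelinear_opens_def by metis

text \<open>If \<open>E\<close> is the closure of an open subset \<open>U \<inter> C\<close> of \<open>C\<close>, the law is applied to \<open>U \<union> (X - C)\<close> and
  \<open>X - E\<close>, which meet only outside \<open>C\<close>. Near a point of \<open>E\<close> the former is not contained in the latter,
  so the latter is contained in the former and hence is empty within \<open>C\<close>.\<close>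

lemma extremally_disconnected_closed_subspace:
  assumes "prelinear_opens X" and C: "closedin X C"
  shows "extremally_disconnected (subtopology X C)"
  unfolding extremally_disconnected_def
proof (intro allI impI)
  fix U' assume "openin (subtopology X C) U'"
  then obtain U where U: "openin X U" "U' = U \<inter> C"
    by (auto simp: openin_subtopology)
  define E where "E = X closure_of U'"
  have EC: "E \<subseteq> C"
    unfolding E_def using C U(2) by (intro closure_of_minimal) auto
  have sub: "U' \<subseteq> E"
    unfolding E_def using U openin_subset[OF U(1)] by (intro closure_of_subset) auto
  have E_eq: "subtopology X C closure_of U' = E"
    using EC U(2) by (simp add: closure_of_subtopology E_def Int_absorb1)
  have "\<exists>T. openin (subtopology X C) T \<and> x \<in> T \<and> T \<subseteq> E" if x: "x \<in> E" for x
  proof -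
    have "openin X (topspace X - C)" "openin X (topspace X - E)"
      using C by (auto simp: E_def)
    moreover have xX: "x \<in> topspace X"
      using x EC closedin_subset[OF C] by blast
    ultimately obtain W where W: "openin X W" "x \<in> W"
      "W \<inter> (U \<union> (topspace X - C)) \<subseteq> topspace X - E \<or> W \<inter> (topspace X - E) \<subseteq> U \<union> (topspace X - C)"
      using prelinear_opensE[OF assms(1), of "U \<union> (topspace X - C)" "topspace X - E" x] U(1) by blast
    obtain y where "y \<in> U'" "y \<in> W"
      using x W(1,2) by (auto simp: E_def in_closure_of)
    then have "W \<inter> (topspace X - E) \<subseteq> U \<union> (topspace X - C)"
      using W(3) sub U(2) by blast
    then have "W \<inter> C \<subseteq> E"
      using sub U(2) openin_subset[OF W(1)] by blast
    moreover have "openin (subtopology X C) (W \<inter> C)"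
      using W(1) by (auto simp: openin_subtopology)
    ultimately show ?thesis
      using x EC W(2) by blast
  qed
  then have "openin (subtopology X C) E"
    by (subst openin_subopen) blast
  then show "openin (subtopology X C) (subtopology X C closure_of U')"
    by (simp add: E_eq)
qed

text \<open>For the forward direction, \<open>E\<close> is the closure of \<open>U - V\<close> in the closed set \<open>C = X - U \<inter> V\<close>. It is
  disjoint from the open set \<open>V - U\<close> of \<open>C\<close>, so, being open in \<open>C\<close>, it gives neighbourhoods in which \<open>V\<close>
  lies in \<open>U\<close>; points of \<open>C\<close> outside \<open>E\<close> have neighbourhoods in which \<open>U\<close> lies in \<open>V\<close>.\<close>

lemma closed_subspaces_extremally_disconnected_iff:
  "(\<forall>C. closedin X C \<longrightarrow> extremally_disconnected (subtopology X C)) \<longleftrightarrow> prelinear_opens X"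
proof
  assume ed: "\<forall>C. closedin X C \<longrightarrow> extremally_disconnected (subtopology X C)"
  show "prelinear_opens X"
  proof (rule prelinear_opensI)
    fix U V x
    assume U: "openin X U" and V: "openin X V" and x: "x \<in> topspace X"
    define C where "C = topspace X - U \<inter> V"
    define E where "E = subtopology X C closure_of (U - V)"
    have "closedin X C"
      unfolding C_def using U V by (intro closedin_diff) auto
    moreover have "U - V = U \<inter> C" "V - U = V \<inter> C"
      using openin_subset[OF U] openin_subset[OF V] by (auto simp: C_def)
    then have UV: "openin (subtopology X C) (U - V)" "openin (subtopology X C) (V - U)"
      using U V by (auto simp: openin_subtopology)
    ultimately have E: "openin (subtopology X C) E"
      using ed unfolding E_def extremally_disconnected_def by blast
    show "\<exists>W. openin X W \<and> x \<in> W \<and> (W \<inter> U \<subseteq> V \<or> W \<inter> V \<subseteq> U)"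
    proof (cases "x \<in> U \<inter> V")
      case True
      then show ?thesis using U by (intro exI[of _ "U \<inter> V"]) (use V in auto)
    next
      case False
      then have xC: "x \<in> topspace (subtopology X C)"
        using x by (simp add: C_def)
      show ?thesis
      proof (cases "x \<in> E")
        case True
        obtain W where W: "openin X W" "E = W \<inter> C"
          using E by (auto simp: openin_subtopology)
        have "E \<inter> (V - U) = {}"
          using openin_Int_closure_of_eq_empty[OF UV(2), of "U - V"] unfolding E_def by blast
        then have "W \<inter> V \<subseteq> U"
          using W(2) openin_subset[OF V] unfolding C_def by blast
        then show ?thesis using True W by blast
      next
        case False
        then obtain T where "openin (subtopology X C) T" "x \<in> T" "T \<inter> (U - V) = {}"
          using xC unfolding E_def in_closure_of by blast
        then obtain W where W: "openin X W" "x \<in> W" "W \<inter> C \<inter> (U - V) = {}"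
          by (auto simp: openin_subtopology)
        then have "W \<inter> U \<subseteq> V"
          using openin_subset[OF U] unfolding C_def by blast
        then show ?thesis using W by blast
      qed
    qed
  qed
next
  assume "prelinear_opens X"
  then show "\<forall>C. closedin X C \<longrightarrow> extremally_disconnected (subtopology X C)"
    by (blast intro: extremally_disconnected_closed_subspace)
qed

section \<open>Alexandrov spaces\<close>

lemma prelinear_opens_alexandrov_space_iff:
  assumes "preorder_on P r"
  shows "prelinear_opens (alexandrov_space P r) \<longleftrightarrow>
    (\<forall>p\<in>P. \<forall>q\<in>P. (\<exists>u\<in>P. (u, p) \<in> r \<and> (u, q) \<in> r) \<longrightarrow> (p, q) \<in> r \<or> (q, p) \<in> r)"
    (is "_ \<longleftrightarrow> ?comparable")
proof -
  define up where "up x = {y\<in>P. (x, y) \<in> r}" for x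
  have refl: "x \<in> up x" if "x \<in> P" for x
    using assms that by (auto simp: up_def preorder_on_def refl_on_def)
  have trans: "up y \<subseteq> up x" if "y \<in> up x" for x y
    using assms that by (auto simp: up_def preorder_on_def dest: transD)
  have up_open: "openin (alexandrov_space P r) (up x)" for x
    unfolding openin_alexandrov_space using trans by (auto simp: up_def)
  have up_least: "up x \<subseteq> W" if "openin (alexandrov_space P r) W" "x \<in> W" for x W
    using that by (auto simp: openin_alexandrov_space up_def)
  show ?thesis
  proof
    assume pre: "prelinear_opens (alexandrov_space P r)"
    show ?comparable
    proof (intro ballI impI)
      fix p q assume pq: "p \<in> P" "q \<in> P" "\<exists>u\<in>P. (u, p) \<in> r \<and> (u, q) \<in> r"
      then obtain u where u: "u \<in> P" "p \<in> up u" "q \<in> up u"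
        by (auto simp: up_def)
      have "u \<in> topspace (alexandrov_space P r)"
        by (simp add: topspace_alexandrov_space u(1))
      from pre up_open up_open this obtain W
        where W: "openin (alexandrov_space P r) W" "u \<in> W" "W \<inter> up p \<subseteq> up q \<or> W \<inter> up q \<subseteq> up p"
        by (rule prelinear_opensE)
      have "p \<in> W \<inter> up p" "q \<in> W \<inter> up q"
        using up_least[OF W(1,2)] u refl pq by auto
      then have "p \<in> up q \<or> q \<in> up p"
        using W(3) by blast
      then show "(p, q) \<in> r \<or> (q, p) \<in> r"
        by (auto simp: up_def)
    qed
  next
    assume comparable: ?comparable
    show "prelinear_opens (alexandrov_space P r)"
    proof (rule prelinear_opensI)
      fix U V x
      assume U: "openin (alexandrov_space P r) U" and V: "openin (alexandrov_space P r) V"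
        and "x \<in> topspace (alexandrov_space P r)"
      then have x: "x \<in> P" by (simp add: topspace_alexandrov_space)
      have "up x \<inter> U \<subseteq> V \<or> up x \<inter> V \<subseteq> U"
      proof (rule ccontr)
        assume "\<not> ?thesis"
        then obtain p q where p: "p \<in> up x" "p \<in> U" "p \<notin> V" and q: "q \<in> up x" "q \<in> V" "q \<notin> U"
          by blast
        then have "(p, q) \<in> r \<or> (q, p) \<in> r"
          using comparable x by (auto simp: up_def)
        then have "q \<in> up p \<or> p \<in> up q"
          using p(1) q(1) by (auto simp: up_def)
        then show False
          using up_least[OF U p(2)] up_least[OF V q(2)] p(3) q(3) by blast
      qed
      then show "\<exists>W. openin (alexandrov_space P r) W \<and> x \<in> W \<and> (W \<inter> U \<subseteq> V \<or> W \<inter> V \<subseteq> U)"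
        using up_open refl[OF x] by blast
    qed
  qed
qed

section \<open>Ideal spaces\<close>

lemma openin_ideal_space_basic: "openin ideal_space {F. semilattice_filter F \<and> m \<in> F}"
  unfolding openin_ideal_space by (intro arbitrary_union_of_inc) blast

lemma openin_ideal_spaceE:
  assumes "openin ideal_space U" "F \<in> U"
  obtains m where "semilattice_filter F" "m \<in> F" "{G. semilattice_filter G \<and> m \<in> G} \<subseteq> U"
  using assms unfolding openin_ideal_space arbitrary_union_of_alt by blast

lemma semilattice_filter_top: "semilattice_filter F \<Longrightarrow> top \<in> F"
  and semilattice_filter_mono: "semilattice_filter F \<Longrightarrow> a \<in> F \<Longrightarrow> a \<le> b \<Longrightarrow> b \<in> F"
  and semilattice_filter_inf: "semilattice_filter F \<Longrightarrow> a \<in> F \<Longrightarrow> b \<in> F \<Longrightarrow> inf a b \<in> F"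
  unfolding semilattice_filter_def by blast+

lemma semilattice_filter_atLeast: "semilattice_filter {m..}"
  unfolding semilattice_filter_def by (auto intro: order_trans)

text \<open>A neighbourhood of the principal filter of \<open>u\<close> contains the basic set of some \<open>m \<ge> u\<close>, and hence
  the principal filters of all elements below \<open>u\<close>. These filters test inclusion between basic sets.
  In the other direction the bound \<open>u\<close> is always available: it can be the top element.\<close>

lemma prelinear_opens_ideal_space_iff:
  "prelinear_opens (ideal_space :: 'm::bounded_semilattice_inf_top set topology) \<longleftrightarrow>
     (\<forall>p q :: 'm. (\<exists>u. p \<le> u \<and> q \<le> u) \<longrightarrow> p \<le> q \<or> q \<le> p)" (is "_ \<longleftrightarrow> ?comparable")
proof -
  define N where "N m = {F. semilattice_filter F \<and> m \<in> F}" for m :: 'm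
  have N_open: "openin ideal_space (N m)" for m
    unfolding N_def by (rule openin_ideal_space_basic)
  have N_mono: "N p \<subseteq> N q" if "p \<le> q" for p q
    using that semilattice_filter_mono by (auto simp: N_def)
  have principal: "{p..} \<in> N q \<longleftrightarrow> p \<le> q" for p q
    by (simp add: N_def semilattice_filter_atLeast)
  show ?thesis
  proof
    assume pre: "prelinear_opens (ideal_space :: 'm set topology)"
    show ?comparable
    proof (intro allI impI)
      fix p q :: 'm assume "\<exists>u. p \<le> u \<and> q \<le> u"
      then obtain u where u: "p \<le> u" "q \<le> u" by blast
      have "{u..} \<in> topspace ideal_space"
        by (simp add: topspace_ideal_space semilattice_filter_atLeast)
      from pre N_open N_open this obtain W
        where W: "openin ideal_space W" "{u..} \<in> W" "W \<inter> N p \<subseteq> N q \<or> W \<inter> N q \<subseteq> N p"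
        by (rule prelinear_opensE)
      obtain m where m: "m \<in> {u..}" "N m \<subseteq> W"
        using W(1,2) unfolding N_def by (rule openin_ideal_spaceE)
      then have "{p..} \<in> W" "{q..} \<in> W"
        using u principal order_trans by (metis atLeast_iff subsetD)+
      then show "p \<le> q \<or> q \<le> p"
        using W(3) principal[of p p] principal[of q q] principal[of p q] principal[of q p] by blast
    qed
  next
    assume comparable: ?comparable
    have total: "p \<le> q \<or> q \<le> p" for p q :: 'm
      using comparable top_greatest by blast
    show "prelinear_opens (ideal_space :: 'm set topology)"
    proof (rule prelinear_opensI)
      fix U V :: "'m set set" and F :: "'m set"
      assume U: "openin ideal_space U" and V: "openin ideal_space V"
        and F: "F \<in> topspace ideal_space"
      have "U \<subseteq> V \<or> V \<subseteq> U"
      proof (rule ccontr)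
        assume "\<not> ?thesis"
        then obtain G H where G: "G \<in> U" "G \<notin> V" and H: "H \<in> V" "H \<notin> U"
          by blast
        obtain p where p: "G \<in> N p" "N p \<subseteq> U"
          using U G(1) unfolding N_def by (rule openin_ideal_spaceE) blast
        obtain q where q: "H \<in> N q" "N q \<subseteq> V"
          using V H(1) unfolding N_def by (rule openin_ideal_spaceE) blast
        show False
          using total[of p q] N_mono[of p q] N_mono[of q p] p q G H by blast
      qed
      then show "\<exists>W. openin ideal_space W \<and> F \<in> W \<and> (W \<inter> U \<subseteq> V \<or> W \<inter> V \<subseteq> U)"
        using F by (intro exI[of _ "topspace ideal_space"]) auto
    qed
  qed
qed

section \<open>Ideals and prime filters of distributive lattices\<close>

definition lattice_ideal :: "'a::bounded_lattice set \<Rightarrow> bool" where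
  "lattice_ideal I \<longleftrightarrow>
     bot \<in> I \<and> (\<forall>a\<in>I. \<forall>b\<le>a. b \<in> I) \<and> (\<forall>a\<in>I. \<forall>b\<in>I. sup a b \<in> I)"

lemma lattice_ideal_bot: "lattice_ideal I \<Longrightarrow> bot \<in> I"
  and lattice_ideal_mono: "lattice_ideal I \<Longrightarrow> a \<in> I \<Longrightarrow> b \<le> a \<Longrightarrow> b \<in> I"
  and lattice_ideal_sup: "lattice_ideal I \<Longrightarrow> a \<in> I \<Longrightarrow> b \<in> I \<Longrightarrow> sup a b \<in> I"
  unfolding lattice_ideal_def by blast+

lemma finite_join_empty [simp]: "finite_join {} = bot"
  by (simp add: finite_join_def)

lemma finite_join_insert [simp]:
  "finite S \<Longrightarrow> finite_join (insert a S) = sup a (finite_join S)"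
  by (simp add: finite_join_def insert_commute[of bot])

lemma finite_join_in_ideal:
  assumes "lattice_ideal I" "finite S" "S \<subseteq> I"
  shows "finite_join S \<in> I"
  using assms(2,3)
  by (induction S) (auto intro: lattice_ideal_bot lattice_ideal_sup assms(1))

lemma finite_join_least: "finite S \<Longrightarrow> (\<And>s. s \<in> S \<Longrightarrow> s \<le> x) \<Longrightarrow> finite_join S \<le> x"
  by (induction S rule: finite_induct) auto

lemma finite_join_union:
  "finite S \<Longrightarrow> finite T \<Longrightarrow> finite_join (S \<union> T) = sup (finite_join S) (finite_join T)"
  by (induction S rule: finite_induct) (auto simp: sup_assoc)

text \<open>Together with the prime filter theorem this replaces compactness of the basic open sets of the
  Stone space: an element of the ideal generated by \<open>K\<close> has a finite cover from \<open>K\<close>.\<close>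

lemma lattice_ideal_generated:
  "lattice_ideal {b. \<exists>S. finite S \<and> S \<subseteq> K \<and> b \<le> finite_join S}"
  unfolding lattice_ideal_def
proof (intro conjI ballI allI impI)
  show "bot \<in> {b. \<exists>S. finite S \<and> S \<subseteq> K \<and> b \<le> finite_join S}"
    by (auto intro: exI[of _ "{}"])
next
  fix a b assume "a \<in> {b. \<exists>S. finite S \<and> S \<subseteq> K \<and> b \<le> finite_join S}" "b \<le> a"
  then show "b \<in> {b. \<exists>S. finite S \<and> S \<subseteq> K \<and> b \<le> finite_join S}"
    using order_trans by blast
next
  fix a b
  assume "a \<in> {b. \<exists>S. finite S \<and> S \<subseteq> K \<and> b \<le> finite_join S}"
    "b \<in> {b. \<exists>S. finite S \<and> S \<subseteq> K \<and> b \<le> finite_join S}"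
  then obtain S T where "finite S" "S \<subseteq> K" "a \<le> finite_join S"
    "finite T" "T \<subseteq> K" "b \<le> finite_join T"
    by blast
  then show "sup a b \<in> {b. \<exists>S. finite S \<and> S \<subseteq> K \<and> b \<le> finite_join S}"
    by (auto simp: finite_join_union intro!: exI[of _ "S \<union> T"] intro: le_supI1 le_supI2)
qed

lemma lattice_ideal_adjoin:
  fixes M :: "'a::bounded_lattice set"
  assumes M: "lattice_ideal M"
  shows "lattice_ideal {c. \<exists>m\<in>M. c \<le> sup m a}"
  unfolding lattice_ideal_def
proof (intro conjI ballI allI impI)
  show "bot \<in> {c. \<exists>m\<in>M. c \<le> sup m a}"
    using lattice_ideal_bot[OF M] by auto
next
  fix c d assume "c \<in> {c. \<exists>m\<in>M. c \<le> sup m a}" "d \<le> c"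
  then show "d \<in> {c. \<exists>m\<in>M. c \<le> sup m a}"
    using order_trans by blast
next
  fix c d assume "c \<in> {c. \<exists>m\<in>M. c \<le> sup m a}" "d \<in> {c. \<exists>m\<in>M. c \<le> sup m a}"
  then obtain m n where mn: "m \<in> M" "n \<in> M" "c \<le> sup m a" "d \<le> sup n a"
    by blast
  have "c \<le> sup (sup m n) a"
    by (rule order_trans[OF mn(3)]) (simp add: le_supI1)
  moreover have "d \<le> sup (sup m n) a"
    by (rule order_trans[OF mn(4)]) (simp add: le_supI1)
  ultimately show "sup c d \<in> {c. \<exists>m\<in>M. c \<le> sup m a}"
    using lattice_ideal_sup[OF M mn(1,2)] le_supI[of c _ d] by blast
qed

text \<open>The filter is the complement of an ideal that is maximal among those avoiding \<open>x\<close>. If it contained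
  \<open>a\<close> and \<open>b\<close> but not \<open>inf a b\<close>, then \<open>x\<close> would be below \<open>sup m a\<close> and below \<open>sup n b\<close> with \<open>m\<close>, \<open>n\<close> in
  the ideal, hence by distributivity below an element of the ideal.\<close>

lemma prime_filter_exists:
  fixes I :: "'a::{distrib_lattice, bounded_lattice} set"
  assumes I: "lattice_ideal I" and x: "x \<notin> I"
  obtains F where "prime_filter F" "x \<in> F" "F \<inter> I = {}"
proof -
  define \<A> where "\<A> = {J. lattice_ideal J \<and> I \<subseteq> J \<and> x \<notin> J}"
  have "\<exists>M\<in>\<A>. \<forall>J\<in>\<A>. M \<subseteq> J \<longrightarrow> J = M"
  proof (rule subset_Zorn_nonempty)
    show "\<A> \<noteq> {}"
      using I x by (auto simp: \<A>_def)
  next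
    fix \<C> assume ne: "\<C> \<noteq> {}" and chain: "subset.chain \<A> \<C>"
    then have ideals: "lattice_ideal J" "I \<subseteq> J" "x \<notin> J" if "J \<in> \<C>" for J
      using that by (auto simp: \<A>_def subset.chain_def)
    have "lattice_ideal (\<Union>\<C>)"
      unfolding lattice_ideal_def
    proof (intro conjI ballI allI impI)
      show "bot \<in> \<Union>\<C>"
        using ne ideals(1) lattice_ideal_bot by blast
    next
      fix a b assume "a \<in> \<Union>\<C>" "b \<le> a"
      then show "b \<in> \<Union>\<C>"
        using ideals(1) lattice_ideal_mono by blast
    next
      fix a b assume "a \<in> \<Union>\<C>" "b \<in> \<Union>\<C>"
      then obtain J J' where J: "J \<in> \<C>" "J' \<in> \<C>" "a \<in> J" "b \<in> J'"
        by blast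
      then have "J \<subseteq> J' \<or> J' \<subseteq> J"
        using chain by (auto simp: subset.chain_def)
      then obtain J'' where "J'' \<in> \<C>" "a \<in> J''" "b \<in> J''"
        using J by blast
      then show "sup a b \<in> \<Union>\<C>"
        using ideals(1) lattice_ideal_sup by blast
    qed
    then show "\<Union>\<C> \<in> \<A>"
      using ne ideals(2,3) by (auto simp: \<A>_def)
  qed
  then obtain M where "M \<in> \<A>" and max: "\<forall>J\<in>\<A>. M \<subseteq> J \<longrightarrow> J = M"
    by (rule bexE)
  then have M: "lattice_ideal M" "I \<subseteq> M" "x \<notin> M"
    by (simp_all add: \<A>_def)
  have maximal: "J = M" if "lattice_ideal J" "x \<notin> J" "M \<subseteq> J" for J
  proof -
    have "J \<in> \<A>" using that M(2) by (auto simp: \<A>_def)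
    then show ?thesis using max that(3) by simp
  qed
  have adjoin: "\<exists>m\<in>M. x \<le> sup m a" if "a \<notin> M" for a
  proof (rule ccontr)
    assume no: "\<not> ?thesis"
    let ?J = "{c. \<exists>m\<in>M. c \<le> sup m a}"
    have "M \<subseteq> ?J"
      using sup_ge1 by blast
    then have "?J = M"
      using no by (intro maximal lattice_ideal_adjoin[OF M(1)]) auto
    moreover have "a \<in> ?J"
      using lattice_ideal_bot[OF M(1)] sup_ge2 by blast
    ultimately show False using that by blast
  qed
  have inf_notin: "inf a b \<notin> M" if ab: "a \<notin> M" "b \<notin> M" for a b
  proof
    assume inf: "inf a b \<in> M"
    obtain m n where mn: "m \<in> M" "x \<le> sup m a" "n \<in> M" "x \<le> sup n b"
      using adjoin ab by meson
    have "x \<le> sup (sup m n) a"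
      by (rule order_trans[OF mn(2)]) (simp add: le_supI1)
    moreover have "x \<le> sup (sup m n) b"
      by (rule order_trans[OF mn(4)]) (simp add: le_supI1)
    ultimately have "x \<le> sup (sup m n) (inf a b)"
      by (simp add: sup_inf_distrib1)
    then show False
      using M(1,3) mn(1,3) inf lattice_ideal_mono lattice_ideal_sup by blast
  qed
  have "semilattice_filter (- M)"
    unfolding semilattice_filter_def
    using M(1,3) inf_notin lattice_ideal_mono[OF M(1)] top_greatest by blast
  then have "prime_filter (- M)"
    unfolding prime_filter_def
    using lattice_ideal_bot[OF M(1)] lattice_ideal_sup[OF M(1)] by blast
  then show thesis
    using that M(2,3) by blast
qed

lemma lattice_ideal_Compl_prime_filter:
  assumes "prime_filter F"
  shows "lattice_ideal (- F)"
  using assms unfolding prime_filter_def semilattice_filter_def lattice_ideal_def by blast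

text \<open>Joining two generators \<open>a\<close>, \<open>a'\<close> gives an element \<open>b\<close> with \<open>b = sup (inf a b) (inf a' b)\<close>, so that
  finite closedness places \<open>b\<close> below a single generator.\<close>

lemma finitely_closed_iff:
  "finitely_closed x A \<longleftrightarrow> (\<forall>a\<in>A. a \<le> x) \<and> lattice_ideal {b. \<exists>a\<in>A. b \<le> a}"
proof
  assume fc: "finitely_closed x A"
  then have below: "\<forall>a\<in>A. a \<le> x"
    unfolding finitely_closed_def by blast
  have covered: "\<exists>a\<in>A. b \<le> a"
    if "b \<le> x" "finite S" "S \<subseteq> A" "b = finite_join ((\<lambda>a. inf a b) ` S)" for b S
    using fc that unfolding finitely_closed_def by blast
  have "lattice_ideal {b. \<exists>a\<in>A. b \<le> a}"
    unfolding lattice_ideal_def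
  proof (intro conjI ballI allI impI)
    show "bot \<in> {b. \<exists>a\<in>A. b \<le> a}"
      using covered[of bot "{}"] by simp
  next
    fix a b assume "a \<in> {b. \<exists>a\<in>A. b \<le> a}" "b \<le> a"
    then show "b \<in> {b. \<exists>a\<in>A. b \<le> a}"
      using order_trans by blast
  next
    fix c d assume "c \<in> {b. \<exists>a\<in>A. b \<le> a}" "d \<in> {b. \<exists>a\<in>A. b \<le> a}"
    then obtain a a' where a: "a \<in> A" "a' \<in> A" "c \<le> a" "d \<le> a'" by blast
    then have "sup c d \<le> sup a a'" by (intro sup_mono)
    moreover have "\<exists>e\<in>A. sup a a' \<le> e"
      using a(1,2) below by (intro covered[of _ "{a, a'}"]) (auto simp: inf_absorb1)
    ultimately show "sup c d \<in> {b. \<exists>a\<in>A. b \<le> a}"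
      using order_trans by blast
  qed
  with below show "(\<forall>a\<in>A. a \<le> x) \<and> lattice_ideal {b. \<exists>a\<in>A. b \<le> a}" ..
next
  assume rhs: "(\<forall>a\<in>A. a \<le> x) \<and> lattice_ideal {b. \<exists>a\<in>A. b \<le> a}"
  have "\<exists>a\<in>A. b \<le> a"
    if S: "finite S" "S \<subseteq> A" "b = finite_join ((\<lambda>a. inf a b) ` S)" for b S
  proof -
    have "(\<lambda>a. inf a b) ` S \<subseteq> {b. \<exists>a\<in>A. b \<le> a}"
      using S(2) inf_le1 by blast
    then have "finite_join ((\<lambda>a. inf a b) ` S) \<in> {b. \<exists>a\<in>A. b \<le> a}"
      using rhs S(1) by (intro finite_join_in_ideal) auto
    then show ?thesis using S(3) by simp
  qed
  then show "finitely_closed x A"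
    using rhs unfolding finitely_closed_def by blast
qed

section \<open>Stone spaces\<close>

lemma openin_stone_space_basic: "openin stone_space {F. prime_filter F \<and> d \<in> F}"
  unfolding openin_stone_space by (intro arbitrary_union_of_inc) blast

lemma openin_stone_spaceE:
  assumes "openin stone_space U" "F \<in> U"
  obtains d where "prime_filter F" "d \<in> F" "{G. prime_filter G \<and> d \<in> G} \<subseteq> U"
  using assms unfolding openin_stone_space arbitrary_union_of_alt by blast

lemma prime_filter_mono: "prime_filter F \<Longrightarrow> a \<in> F \<Longrightarrow> a \<le> b \<Longrightarrow> b \<in> F"
  unfolding prime_filter_def using semilattice_filter_mono by blast

lemma prime_filter_inf_iff: "prime_filter F \<Longrightarrow> inf a b \<in> F \<longleftrightarrow> a \<in> F \<and> b \<in> F"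
  by (meson inf_le1 inf_le2 prime_filter_def prime_filter_mono semilattice_filter_inf)

lemma prime_filter_finite_join:
  assumes "prime_filter F" "finite S" "finite_join S \<in> F"
  obtains s where "s \<in> S" "s \<in> F"
  using finite_join_in_ideal[OF lattice_ideal_Compl_prime_filter[OF assms(1)] assms(2)] assms(3)
  by blast

text \<open>For open \<open>U\<close> this is the ideal from which \<open>U\<close> is recovered as a union of basic open sets.\<close>

lemma lattice_ideal_basic_subsets:
  "lattice_ideal {d. {F. prime_filter F \<and> d \<in> F} \<subseteq> U}"
  unfolding lattice_ideal_def
proof (intro conjI ballI allI impI)
  show "bot \<in> {d. {F. prime_filter F \<and> d \<in> F} \<subseteq> U}"
    by (auto simp: prime_filter_def)
next
  fix a b :: 'a assume "a \<in> {d. {F. prime_filter F \<and> d \<in> F} \<subseteq> U}" "b \<le> a"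
  then show "b \<in> {d. {F. prime_filter F \<and> d \<in> F} \<subseteq> U}"
    using prime_filter_mono by blast
next
  fix a b :: 'a
  assume "a \<in> {d. {F. prime_filter F \<and> d \<in> F} \<subseteq> U}" "b \<in> {d. {F. prime_filter F \<and> d \<in> F} \<subseteq> U}"
  then show "sup a b \<in> {d. {F. prime_filter F \<and> d \<in> F} \<subseteq> U}"
    unfolding prime_filter_def by blast
qed

text \<open>A prime filter that contains \<open>inf a c\<close> but no element of \<open>B\<close> would be a point at which the
  inclusion fails.\<close>

lemma refines_if_basic_Int_subset:
  fixes A B :: "'a::{distrib_lattice, bounded_lattice} set"
  assumes B: "lattice_ideal {d. \<exists>b\<in>B. d \<le> b}"
    and sub: "{F. prime_filter F \<and> c \<in> F} \<inter> {F. prime_filter F \<and> (\<exists>a\<in>A. a \<in> F)}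
                \<subseteq> {F. prime_filter F \<and> (\<exists>b\<in>B. b \<in> F)}"
  shows "refines ((\<lambda>a. inf a c) ` A) ((\<lambda>b. inf b c) ` B)"
proof -
  have "\<exists>b\<in>B. inf a c \<le> b" if a: "a \<in> A" for a
  proof (rule ccontr)
    assume "\<not> ?thesis"
    then have "inf a c \<notin> {d. \<exists>b\<in>B. d \<le> b}" by simp
    then obtain F where F: "prime_filter F" "inf a c \<in> F" "F \<inter> {d. \<exists>b\<in>B. d \<le> b} = {}"
      using prime_filter_exists[OF B] by blast
    then have "F \<in> {F. prime_filter F \<and> (\<exists>b\<in>B. b \<in> F)}"
      using a sub by (auto simp: prime_filter_inf_iff)
    then show False using F(3) by blast
  qed
  then show ?thesis
    unfolding refines_def by fastforce
qed

lemma goedel_dummettI: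
  assumes pre: "prelinear_opens (stone_space :: 'd::{distrib_lattice, bounded_lattice} set topology)"
  shows "goedel_dummett TYPE('d)"
  unfolding goedel_dummett_def
proof (intro allI impI)
  fix x :: 'd and A B
  assume "finitely_closed x A \<and> finitely_closed x B"
  then have A: "lattice_ideal {d. \<exists>a\<in>A. d \<le> a}" and B: "lattice_ideal {d. \<exists>b\<in>B. d \<le> b}"
    by (auto simp: finitely_closed_iff)
  define N where "N d = {F. prime_filter F \<and> d \<in> F}" for d :: 'd
  define gen where "gen S = {F. prime_filter F \<and> (\<exists>a\<in>S. a \<in> F)}" for S :: "'d set"
  define K where "K = {c. c \<le> x \<and>
    (refines ((\<lambda>a. inf a c) ` A) ((\<lambda>b. inf b c) ` B) \<or>
     refines ((\<lambda>b. inf b c) ` B) ((\<lambda>a. inf a c) ` A))}"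
  have gen_open: "openin stone_space (gen S)" for S
  proof -
    have "gen S = (\<Union>a\<in>S. N a)" by (auto simp: gen_def N_def)
    then show ?thesis
      using openin_stone_space_basic by (auto simp: N_def)
  qed
  \<comment> \<open>A prime filter containing \<open>x\<close> has a member in \<open>K\<close>, so it meets the ideal generated by \<open>K\<close>; hence
    this ideal contains \<open>x\<close>.\<close>
  have "x \<in> {b. \<exists>S. finite S \<and> S \<subseteq> K \<and> b \<le> finite_join S}"
  proof (rule ccontr)
    assume "x \<notin> {b. \<exists>S. finite S \<and> S \<subseteq> K \<and> b \<le> finite_join S}"
    then obtain F where F: "prime_filter F" "x \<in> F"
      and disj: "F \<inter> {b. \<exists>S. finite S \<and> S \<subseteq> K \<and> b \<le> finite_join S} = {}"
      using prime_filter_exists[OF lattice_ideal_generated] by blast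
    have "F \<in> topspace stone_space"
      by (simp add: topspace_stone_space F(1))
    from pre gen_open gen_open this obtain W
      where W: "openin stone_space W" "F \<in> W"
        "W \<inter> gen A \<subseteq> gen B \<or> W \<inter> gen B \<subseteq> gen A"
      by (rule prelinear_opensE)
    obtain d where d: "d \<in> F" "N d \<subseteq> W"
      using W(1,2) unfolding N_def by (rule openin_stone_spaceE)
    have "N (inf d x) \<subseteq> W"
      using d(2) by (auto simp: N_def prime_filter_inf_iff)
    then have "N (inf d x) \<inter> gen A \<subseteq> gen B \<or> N (inf d x) \<inter> gen B \<subseteq> gen A"
      using W(3) by blast
    then have "inf d x \<in> K"
      using refines_if_basic_Int_subset[OF B, of "inf d x" A]
        refines_if_basic_Int_subset[OF A, of "inf d x" B]
      unfolding K_def N_def gen_def by auto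
    then have "inf d x \<in> {b. \<exists>S. finite S \<and> S \<subseteq> K \<and> b \<le> finite_join S}"
      by (auto intro!: exI[of _ "{inf d x}"])
    moreover have "inf d x \<in> F"
      using F d(1) by (simp add: prime_filter_inf_iff)
    ultimately show False using disj by blast
  qed
  then obtain S where S: "finite S" "S \<subseteq> K" "x \<le> finite_join S" by blast
  moreover have "finite_join S \<le> x"
    using S(1,2) by (intro finite_join_least) (auto simp: K_def)
  ultimately show "\<exists>C. finite C \<and> x = finite_join C \<and>
      (\<forall>c\<in>C. refines ((\<lambda>a. inf a c) ` A) ((\<lambda>b. inf b c) ` B) \<or>
              refines ((\<lambda>b. inf b c) ` B) ((\<lambda>a. inf a c) ` A))"
    by (intro exI[of _ S]) (auto simp: K_def)
qed

text \<open>The condition is applied with the top element for \<open>x\<close> and with the ideals of two open sets; the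
  neighbourhood is the basic open set of a member of the cover lying in the given prime filter.\<close>

lemma prelinear_opens_stone_spaceI:
  assumes gd: "goedel_dummett TYPE('d::{distrib_lattice, bounded_lattice})"
  shows "prelinear_opens (stone_space :: 'd set topology)"
proof (rule prelinear_opensI)
  fix U V :: "'d set set" and F :: "'d set"
  assume U: "openin stone_space U" and V: "openin stone_space V"
    and "F \<in> topspace stone_space"
  then have F: "prime_filter F" by (simp add: topspace_stone_space)
  define N where "N d = {F. prime_filter F \<and> d \<in> F}" for d :: 'd
  define ideal where "ideal U = {d. N d \<subseteq> U}" for U
  have closed: "finitely_closed top (ideal U)" for U
  proof -
    have I: "lattice_ideal (ideal U)"
      unfolding ideal_def N_def by (rule lattice_ideal_basic_subsets)
    have "{b. \<exists>a\<in>ideal U. b \<le> a} = ideal U"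
      using lattice_ideal_mono[OF I] by auto
    with I show ?thesis by (simp add: finitely_closed_iff)
  qed
  obtain C where C: "finite C" "top = finite_join C"
    "\<And>c. c \<in> C \<Longrightarrow> refines ((\<lambda>a. inf a c) ` ideal U) ((\<lambda>b. inf b c) ` ideal V) \<or>
                   refines ((\<lambda>b. inf b c) ` ideal V) ((\<lambda>a. inf a c) ` ideal U)"
    using gd closed[of U] closed[of V] unfolding goedel_dummett_def by meson
  have "finite_join C \<in> F"
    using F C(2) semilattice_filter_top by (auto simp: prime_filter_def)
  then obtain c where c: "c \<in> C" "c \<in> F"
    using prime_filter_finite_join[OF F C(1)] by blast
  have sub: "N c \<inter> U \<subseteq> V"
    if U: "openin stone_space U" and ref: "refines ((\<lambda>a. inf a c) ` ideal U) ((\<lambda>b. inf b c) ` ideal V)"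
    for U V
  proof
    fix G assume G: "G \<in> N c \<inter> U"
    then obtain d where d: "d \<in> G" "d \<in> ideal U"
      using openin_stone_spaceE[OF U] unfolding ideal_def N_def by blast
    obtain b where b: "b \<in> ideal V" "inf d c \<le> inf b c"
      using ref d(2) unfolding refines_def by blast
    have "inf d c \<in> G"
      using G d(1) by (simp add: N_def prime_filter_inf_iff)
    then have "inf b c \<in> G"
      using prime_filter_mono[of G "inf d c" "inf b c"] b(2) G by (simp add: N_def)
    then have "G \<in> N b"
      using G by (simp add: N_def prime_filter_inf_iff)
    then show "G \<in> V"
      using b(1) by (auto simp: ideal_def)
  qed
  have "N c \<inter> U \<subseteq> V \<or> N c \<inter> V \<subseteq> U"
    using C(3)[OF c(1)] sub U V by blast
  moreover have "openin stone_space (N c)"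
    unfolding N_def by (rule openin_stone_space_basic)
  ultimately show "\<exists>W. openin stone_space W \<and> F \<in> W \<and> (W \<inter> U \<subseteq> V \<or> W \<inter> V \<subseteq> U)"
    using F c(2) by (auto simp: N_def)
qed

lemma prelinear_opens_stone_space_iff:
  "prelinear_opens (stone_space :: 'd::{distrib_lattice, bounded_lattice} set topology)
     \<longleftrightarrow> goedel_dummett TYPE('d)"
  by (rule iffI[OF goedel_dummettI prelinear_opens_stone_spaceI])

section \<open>The three characterizations\<close>

theorem theorem7p12:
  fixes P :: "'p set" and r :: "('p \<times> 'p) set"
  shows
    "((\<forall>C. closedin (stone_space :: 'd::{distrib_lattice, bounded_lattice} set topology) C \<longrightarrow>
          extremally_disconnected (subtopology stone_space C))
        \<longleftrightarrow> goedel_dummett TYPE('d)) \<and>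
     ((\<forall>C. closedin (ideal_space :: 'm::bounded_semilattice_inf_top set topology) C \<longrightarrow>
          extremally_disconnected (subtopology ideal_space C))
        \<longleftrightarrow> (\<forall>p q :: 'm. (\<exists>u. p \<le> u \<and> q \<le> u) \<longrightarrow> p \<le> q \<or> q \<le> p)) \<and>
     (preorder_on P r \<longrightarrow>
        ((\<forall>C. closedin (alexandrov_space P r) C \<longrightarrow>
            extremally_disconnected (subtopology (alexandrov_space P r) C))
          \<longleftrightarrow> (\<forall>p\<in>P. \<forall>q\<in>P. (\<exists>u\<in>P. (u, p) \<in> r \<and> (u, q) \<in> r) \<longrightarrow> (p, q) \<in> r \<or> (q, p) \<in> r)))"

  unfolding closed_subspaces_extremally_disconnected_iff
  by (intro conjI impI prelinear_opens_stone_space_iff prelinear_opens_ideal_space_iff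
      prelinear_opens_alexandrov_space_iff)

end
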